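(* Let $X$ be a real Banach space, let $\varphi:X\to\mathbb{R}$ be linear and continuous, and let $\psi:X\to\mathbb{R}$ be non-negative and Lipschitzian, with Lipschitz constant equal to $\|\varphi\|_{X^*}$. Then, for each constant $c\ge 1+\sqrt2$, one has $$\inf_{x\in X}\left(c\varphi(x)+(c-\sqrt2)\psi(x)+\sqrt{|\varphi(x)|^2+|\psi(x)|^2}\right)=\left(c-\frac{1}{\sqrt2}\right)\inf_{x\in X}\left(\varphi(x)+\psi(x)\right).$$
   Context: $\|\varphi\|_{X^*}$ is the dual norm of $\varphi$. $\psi$ is Lipschitzian with Lipschitz constant $L$ if $|\psi(x)-\psi(y)|\le L\|x-y\|$ for all $x,y\in X$. Infima are taken in the extended real line.
   Formalization: The formal theorem also assumes that φ is not identically zero; for φ = 0 and ψ a positive constant k the claimed identity would read (c − √2 + 1)k = (c − 1/√2)k, which is false. *)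

theory Defs
  imports "HOL-Analysis.Analysis"
begin

end

(* Write a = \<phi> x, b = \<psi> x and F(a, b) for the functional on the left. Since
   sqrt (a^2 + b^2) \<ge> (b - a) / sqrt 2, one has F(a, b) \<ge> (c - 1 / sqrt 2) (a + b), with
   near equality when b - a is large compared with \<bar>a + b\<bar>. From any point x one can travel
   in an almost norming direction of \<phi> so that \<phi> drops by t while \<psi>, having Lipschitz
   constant equal to the norm of \<phi>, grows by at most t + 1 / t. As F is increasing in b \<ge> 0,
   letting t tend to infinity shows that inf F \<le> (c - 1 / sqrt 2) (\<phi> x + \<psi> x). *)
theory Submission
  imports Defs "HOL-Real_Asymp.Real_Asymp"
begin

text \<open>The difference \<open>2 * (a^2 + b^2) - (b - a)^2\<close> is the square of
  \<open>a + b\<close>, so the bound is sharp on the ray \<open>b = - a\<close>,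
  \<open>b \<ge> 0\<close>.\<close>

lemma sqrt_sum_squares_ge_diff:
  fixes a b :: real
  shows "(b - a) / sqrt 2 \<le> sqrt (a\<^sup>2 + b\<^sup>2)"
proof -
  have "((b - a) / sqrt 2)\<^sup>2 \<le> a\<^sup>2 + b\<^sup>2"
    using zero_le_power2[of "a + b"] by (simp add: power_divide power2_eq_square algebra_simps)
  then show ?thesis
    by (rule real_le_rsqrt)
qed

text \<open>Otherwise \<open>onorm \<phi> / (1 + \<delta>)\<close> would be a bound for \<phi> below
  its norm. The vector found is rescaled so that a step \<open>t\<close> along \<open>u\<close>
  lowers \<phi> by exactly \<open>t\<close>.\<close>

lemma onorm_almost_norming_vector:
  fixes \<phi> :: "'a::real_normed_vector \<Rightarrow> real"
  assumes "bounded_linear \<phi>" and "\<phi> \<noteq> (\<lambda>x. 0)" and "\<delta> > 0"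
  obtains u where "\<phi> u = - 1" and "onorm \<phi> * norm u \<le> 1 + \<delta>"
proof -
  interpret bounded_linear \<phi> by fact
  have pos: "onorm \<phi> > 0"
    using assms(1,2) onorm_pos_lt by blast
  have "\<exists>x. onorm \<phi> * norm x < (1 + \<delta>) * norm (\<phi> x)"
  proof (rule ccontr)
    assume "\<not> ?thesis"
    then have "norm (\<phi> x) \<le> onorm \<phi> / (1 + \<delta>) * norm x" for x
      using \<open>\<delta> > 0\<close> by (auto simp: not_less field_simps)
    then have "onorm \<phi> \<le> onorm \<phi> / (1 + \<delta>)"
      using onorm_bound[of "onorm \<phi> / (1 + \<delta>)" \<phi>] pos \<open>\<delta> > 0\<close> by simp
    then show False
      using mult_pos_pos[OF \<open>\<delta> > 0\<close> pos] \<open>\<delta> > 0\<close> by (simp add: field_simps)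
  qed
  then obtain x where x: "onorm \<phi> * norm x < (1 + \<delta>) * \<bar>\<phi> x\<bar>"
    by auto
  then have nz: "\<phi> x \<noteq> 0"
    using pos by (auto simp: mult_less_0_iff)
  show thesis
  proof (rule that)
    show "\<phi> (- (1 / \<phi> x) *\<^sub>R x) = - 1"
      using nz by (simp add: scaleR neg)
    show "onorm \<phi> * norm (- (1 / \<phi> x) *\<^sub>R x) \<le> 1 + \<delta>"
      using x nz by (simp add: field_simps)
  qed
qed

text \<open>The radicand is \<open>2 * t^2 + 2 * (b - a) * t + O(1)\<close>; multiplying by the
  conjugate and dividing by \<open>t\<close> leaves \<open>2 * (b - a)\<close> over
  \<open>2 * sqrt 2\<close> in the limit.\<close>

lemma tendsto_sqrt_minus_linear:
  fixes a b :: real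
  shows "((\<lambda>t. sqrt ((a - t)\<^sup>2 + (b + t + 1 / t)\<^sup>2) - sqrt 2 * t) \<longlongrightarrow> (b - a) / sqrt 2) at_top"
proof -
  define P where "P t = (a - t)\<^sup>2 + (b + t + 1 / t)\<^sup>2" for t
  have "((\<lambda>t. (P t - 2 * t\<^sup>2) / t) \<longlongrightarrow> 2 * (b - a)) at_top"
    and "((\<lambda>t. P t / t\<^sup>2) \<longlongrightarrow> 2) at_top"
    unfolding P_def by real_asymp+
  then have lim: "((\<lambda>t. ((P t - 2 * t\<^sup>2) / t) / (sqrt (P t / t\<^sup>2) + sqrt 2))
      \<longlongrightarrow> 2 * (b - a) / (sqrt 2 + sqrt 2)) at_top"
    by (intro tendsto_divide tendsto_add tendsto_real_sqrt tendsto_const) simp_all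
  have "\<forall>\<^sub>F t in at_top. ((P t - 2 * t\<^sup>2) / t) / (sqrt (P t / t\<^sup>2) + sqrt 2) = sqrt (P t) - sqrt 2 * t"
    using eventually_gt_at_top[of 0]
  proof eventually_elim
    case (elim t)
    have "P t \<ge> 0"
      unfolding P_def by simp
    then have "P t - 2 * t\<^sup>2 = (sqrt (P t) - sqrt 2 * t) * (sqrt (P t) + sqrt 2 * t)"
      by (simp add: algebra_simps power2_eq_square)
    moreover have "sqrt (P t) + sqrt 2 * t > 0"
      using elim \<open>P t \<ge> 0\<close> by (intro add_nonneg_pos) auto
    moreover have "sqrt (P t / t\<^sup>2) + sqrt 2 = (sqrt (P t) + sqrt 2 * t) / t"
      using elim by (simp add: real_sqrt_divide add_divide_distrib)
    ultimately show ?case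
      using elim by simp
  qed
  then have "((\<lambda>t. sqrt (P t) - sqrt 2 * t) \<longlongrightarrow> 2 * (b - a) / (sqrt 2 + sqrt 2)) at_top"
    using lim by (rule Lim_transform_eventually[rotated])
  moreover have "2 * (b - a) / (sqrt 2 + sqrt 2) = (b - a) / sqrt 2"
    by (simp add: field_simps)
  ultimately show ?thesis
    unfolding P_def by (simp only:)
qed

text \<open>The linear terms contribute \<open>- sqrt 2 * t\<close>, which cancels the leading
  growth of the square root.\<close>

lemma tendsto_along_antidiagonal:
  fixes a b c :: real
  shows "((\<lambda>t. c * (a - t) + (c - sqrt 2) * (b + t + 1 / t)
            + sqrt ((a - t)\<^sup>2 + (b + t + 1 / t)\<^sup>2))
          \<longlongrightarrow> (c - 1 / sqrt 2) * (a + b)) at_top"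
proof -
  have "((\<lambda>t. x + y * (1 / t)) \<longlongrightarrow> x) at_top" for x y :: real
    by real_asymp
  then have "((\<lambda>t. (c * a + (c - sqrt 2) * b) + (c - sqrt 2) * (1 / t))
      \<longlongrightarrow> c * a + (c - sqrt 2) * b) at_top" .
  moreover have "((\<lambda>t. sqrt ((a - t)\<^sup>2 + (b + t + 1 / t)\<^sup>2) - sqrt 2 * t) \<longlongrightarrow> (b - a) / sqrt 2) at_top"
    by (rule tendsto_sqrt_minus_linear)
  ultimately have "((\<lambda>t. (c * a + (c - sqrt 2) * b) + (c - sqrt 2) * (1 / t)
      + (sqrt ((a - t)\<^sup>2 + (b + t + 1 / t)\<^sup>2) - sqrt 2 * t))
      \<longlongrightarrow> c * a + (c - sqrt 2) * b + (b - a) / sqrt 2) at_top"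
    by (rule tendsto_add)
  moreover have "(c * a + (c - sqrt 2) * b) + (c - sqrt 2) * (1 / t)
      + (sqrt ((a - t)\<^sup>2 + (b + t + 1 / t)\<^sup>2) - sqrt 2 * t)
      = c * (a - t) + (c - sqrt 2) * (b + t + 1 / t) + sqrt ((a - t)\<^sup>2 + (b + t + 1 / t)\<^sup>2)" for t
    by (simp add: algebra_simps)
  moreover have "c * a + (c - sqrt 2) * b + (b - a) / sqrt 2 = (c - 1 / sqrt 2) * (a + b)"
    by (simp add: field_simps)
  ultimately show ?thesis
    by (simp only:)
qed

theorem proposition1p1:
  fixes \<phi> \<psi> :: "'a::banach \<Rightarrow> real" and c :: real
  assumes "bounded_linear \<phi>"
    and "\<phi> \<noteq> (\<lambda>x. 0)"
    and "\<And>x. 0 \<le> \<psi> x"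
    and "(onorm \<phi>)-lipschitz_on UNIV \<psi>"
    and "c \<ge> 1 + sqrt 2"
  shows "(INF x. ereal (c * \<phi> x + (c - sqrt 2) * \<psi> x + sqrt (\<bar>\<phi> x\<bar>\<^sup>2 + \<bar>\<psi> x\<bar>\<^sup>2)))
    = ereal (c - 1 / sqrt 2) * (INF x. ereal (\<phi> x + \<psi> x))"
proof -
  interpret bounded_linear \<phi> by fact
  define F where "F a b = c * a + (c - sqrt 2) * b + sqrt (a\<^sup>2 + b\<^sup>2)" for a b
  define K where "K = c - 1 / sqrt 2"
  have r2: "1 / sqrt 2 = sqrt 2 / 2"
    by (simp add: field_simps)
  have K: "K > 0"
    using assms(5) real_sqrt_ge_zero[of 2] unfolding K_def r2 by linarith
  have lower: "K * (a + b) \<le> F a b" for a b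
  proof -
    have "K * (a + b) = c * a + (c - sqrt 2) * b + (b - a) / sqrt 2"
      unfolding K_def by (simp add: field_simps)
    then show ?thesis
      using sqrt_sum_squares_ge_diff[of b a] unfolding F_def by linarith
  qed
  \<comment> \<open>Here the bound on \<open>c\<close> enters: the coefficient
    \<open>c - sqrt 2\<close> is at least 1, and the root increases with
    \<open>b \<ge> 0\<close>.\<close>
  have F_mono: "F a b \<le> F a b'" if "0 \<le> b" "b \<le> b'" for a b b'
    unfolding F_def using that assms(5)
    by (intro add_mono order_refl[of "c * a"] order_refl[of "a\<^sup>2"] mult_left_mono
        real_sqrt_le_mono power_mono) (auto simp: algebra_simps)
  have upper: "(INF y. ereal (F (\<phi> y) (\<psi> y))) \<le> ereal (K * (\<phi> x + \<psi> x))" for x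
  proof (rule tendsto_lowerbound)
    show "((\<lambda>t. ereal (F (\<phi> x - t) (\<psi> x + t + 1 / t))) \<longlongrightarrow> ereal (K * (\<phi> x + \<psi> x))) at_top"
      unfolding F_def K_def by (intro tendsto_ereal tendsto_along_antidiagonal)
    show "\<forall>\<^sub>F t in at_top. (INF y. ereal (F (\<phi> y) (\<psi> y))) \<le> ereal (F (\<phi> x - t) (\<psi> x + t + 1 / t))"
      using eventually_gt_at_top[of 0]
    proof eventually_elim
      case (elim t)
      \<comment> \<open>The slack \<open>1 / t^2\<close> still costs only \<open>1 / t\<close>,
        which vanishes in the limit, after a step of length factor \<open>t\<close>.\<close>
      then obtain u where u: "\<phi> u = - 1" "onorm \<phi> * norm u \<le> 1 + 1 / t\<^sup>2"
        using onorm_almost_norming_vector[OF assms(1,2), of "1 / t\<^sup>2"] by auto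
      let ?y = "x + t *\<^sub>R u"
      have "\<bar>\<psi> ?y - \<psi> x\<bar> \<le> onorm \<phi> * (t * norm u)"
        using lipschitz_onD[OF assms(4), of ?y x] elim by (simp add: dist_norm)
      also have "\<dots> \<le> t * (1 + 1 / t\<^sup>2)"
        using mult_left_mono[OF u(2), of t] elim by (simp add: algebra_simps)
      also have "\<dots> = t + 1 / t"
        using elim by (simp add: field_simps power2_eq_square)
      finally have "\<psi> ?y \<le> \<psi> x + t + 1 / t"
        by linarith
      moreover have "\<phi> ?y = \<phi> x - t"
        using u by (simp add: add scaleR)
      \<comment> \<open>Only an upper bound on \<psi> at \<open>?y\<close> is known, so monotonicity
        in the second argument replaces its true value.\<close>
      ultimately have "F (\<phi> ?y) (\<psi> ?y) \<le> F (\<phi> x - t) (\<psi> x + t + 1 / t)"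
        using F_mono assms(3) by simp
      then show ?case
        by (intro INF_lower2[of ?y]) auto
    qed
  qed simp
  have "(INF x. ereal (F (\<phi> x) (\<psi> x))) = (INF x. ereal K * ereal (\<phi> x + \<psi> x))"
    using lower upper by (intro antisym INF_mono INF_greatest) auto
  \<comment> \<open>Since \<open>K > 0\<close>, the factor leaves the infimum even when that infimum
    is minus infinity.\<close>
  also have "\<dots> = ereal K * (INF x. ereal (\<phi> x + \<psi> x))"
    using ereal_Inf_cmult[OF K, of "\<lambda>y. y \<in> range (\<lambda>x. ereal (\<phi> x + \<psi> x))"]
    by (simp add: setcompr_eq_image image_image)
  finally show ?thesis
    by (simp add: F_def K_def)
qed

end
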